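(* The set $R^+_{ure}$ of all $e$ such that $\mathrm{RTD}^+(\mathcal L_e)$ is finite and witnessed by a uniformly r.e. positive teaching sequence for $\mathcal L_e$ is $\Sigma^0_5$-hard.
   Context: $W_0,W_1,\ldots$ is an acceptable numbering of all r.e. subsets of $\mathbb N$; $L^e_j = \{x : \langle j,x\rangle \in W_e\}$ and $\mathcal L_e = \{L^e_j : j\in\mathbb N\}$. A positive teaching sequence for a family $\mathcal L$ is a sequence $((\mathcal F_0,d_0),(\mathcal F_1,d_1),\ldots)$ (indexed by an initial segment of $\mathbb N$) such that (i) the $\mathcal F_i$ are nonempty and form a partition of $\mathcal L$, and (ii) for every $i$ and every $L\in\mathcal F_i$ there is $S_L\subseteq L$ with $|S_L| = d_i<\infty$ such that for all $L'\in\bigcup_{j\geq i}\mathcal F_j$, $S_L\subseteq L'$ implies $L=L'$. Its order is $\sup_i d_i$, and $\mathrm{RTD}^+(\mathcal L)$ is the infimum of orders of positive teaching sequences for $\mathcal L$. The sequence is uniformly r.e. if the families $\mathcal F_i$ are uniformly r.e., i.e. there is an r.e. set $W$ with $\mathcal F_i = \{\{x : \langle i,j,x\rangle\in W\} : j\in\mathbb N\}$ for all $i$. "Finite and witnessed by" means there is such a uniformly r.e. positive teaching sequence of finite order. A set is $\Sigma^0_5$-hard if every $\Sigma^0_5$ set many-one reduces to it via a recursive function. *)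

theory Defs
  imports "HOL-Library.Nat_Bijection" "HOL-Library.Extended_Nat" "HOL-Library.Disjoint_Sets"
begin

section \<open>Partial recursive functions\<close>

datatype recf =
    Zero
  | Succ
  | Proj nat
  | Comp recf "recf list"
  | PrimRec recf recf
  | Mu recf

text \<open>Programs carry no arity. Applied to an argument list whose length does not suit
  a constructor, a program diverges (\<^const>\<open>None\<close>), so its restriction to the lists of any
  fixed length is an ordinary partial recursive function.\<close>

fun eval :: "recf \<Rightarrow> nat list \<Rightarrow> nat option" where
  "eval Zero xs = Some 0"
| "eval Succ xs = (case xs of [x] \<Rightarrow> Some (Suc x) | _ \<Rightarrow> None)"
| "eval (Proj i) xs = (if i < length xs then Some (xs ! i) else None)"
| "eval (Comp f gs) xs =
     (let ys = map (\<lambda>g. eval g xs) gs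
      in if None \<in> set ys then None else eval f (map the ys))"
| "eval (PrimRec f g) xs =
     (case xs of
        [] \<Rightarrow> None
      | n # zs \<Rightarrow>
          rec_nat (eval f zs) (\<lambda>m r. Option.bind r (\<lambda>y. eval g (m # y # zs))) n)"
| "eval (Mu f) xs =
     (if \<exists>n. eval f (n # xs) = Some 0 \<and> (\<forall>m<n. eval f (m # xs) \<noteq> None)
      then Some (LEAST n. eval f (n # xs) = Some 0)
      else None)"

definition recursive_fun :: "(nat \<Rightarrow> nat) \<Rightarrow> bool" where
  "recursive_fun f \<longleftrightarrow> (\<exists>r. \<forall>x. eval r [x] = Some (f x))"

definition recursive_set :: "nat set \<Rightarrow> bool" where
  "recursive_set A \<longleftrightarrow> (\<exists>f. recursive_fun f \<and> (\<forall>x. f x = (if x \<in> A then 1 else 0)))"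

definition re_set :: "nat set \<Rightarrow> bool" where
  "re_set A \<longleftrightarrow> (\<exists>r. A = {x. eval r [x] \<noteq> None})"


section \<open>Acceptable numberings of the r.e. sets\<close>

text \<open>The pairing function is the Cantor bijection \<^const>\<open>prod_encode\<close>; triples
  are coded as \<open>\<langle>i, \<langle>j, x\<rangle>\<rangle>\<close>.\<close>

definition uniformly_re :: "(nat \<Rightarrow> nat set) \<Rightarrow> bool" where
  "uniformly_re V \<longleftrightarrow> re_set {prod_encode (e, x) | e x. x \<in> V e}"

text \<open>Acceptability in the sense of Rogers: every uniformly r.e. sequence of sets
  translates recursively into the numbering.\<close>

definition acceptable_numbering :: "(nat \<Rightarrow> nat set) \<Rightarrow> bool" where
  "acceptable_numbering W \<longleftrightarrow>
     range W = {A. re_set A} \<and>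
     uniformly_re W \<and>
     (\<forall>V. uniformly_re V \<longrightarrow> (\<exists>f. recursive_fun f \<and> (\<forall>e. V e = W (f e))))"


section \<open>The arithmetical hierarchy and many-one reducibility\<close>

text \<open>The set \<open>B\<close> below is \<open>\<Pi>\<^sup>0\<^sub>n\<close>, i.e. its complement is \<open>\<Sigma>\<^sup>0\<^sub>n\<close>.\<close>

fun arith_Sigma :: "nat \<Rightarrow> nat set \<Rightarrow> bool" where
  "arith_Sigma 0 A \<longleftrightarrow> recursive_set A"
| "arith_Sigma (Suc n) A \<longleftrightarrow>
     (\<exists>B. arith_Sigma n (- B) \<and> A = {x. \<exists>y. prod_encode (x, y) \<in> B})"

definition many_one_reducible :: "nat set \<Rightarrow> nat set \<Rightarrow> bool" where
  "many_one_reducible A B \<longleftrightarrow> (\<exists>f. recursive_fun f \<and> (\<forall>x. x \<in> A \<longleftrightarrow> f x \<in> B))"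

definition Sigma_hard :: "nat \<Rightarrow> nat set \<Rightarrow> bool" where
  "Sigma_hard n B \<longleftrightarrow> (\<forall>A. arith_Sigma n A \<longrightarrow> many_one_reducible A B)"


section \<open>Positive teaching sequences\<close>

definition lang :: "(nat \<Rightarrow> nat set) \<Rightarrow> nat \<Rightarrow> nat \<Rightarrow> nat set" where
  "lang W e j = {x. prod_encode (j, x) \<in> W e}"

definition lang_family :: "(nat \<Rightarrow> nat set) \<Rightarrow> nat \<Rightarrow> nat set set" where
  "lang_family W e = {lang W e j | j. True}"

text \<open>A sequence \<open>((F 0, d 0), (F 1, d 1), \<dots>)\<close> is given by its index set \<open>I\<close> (an initial
  segment of the naturals, finite or not) and the functions \<open>F\<close> and \<open>d\<close>, whose values
  outside \<open>I\<close> are irrelevant.\<close>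

definition positive_teaching_seq ::
  "nat set set \<Rightarrow> nat set \<Rightarrow> (nat \<Rightarrow> nat set set) \<Rightarrow> (nat \<Rightarrow> nat) \<Rightarrow> bool" where
  "positive_teaching_seq \<L> I F d \<longleftrightarrow>
     (\<forall>i\<in>I. \<forall>j<i. j \<in> I) \<and>
     (\<forall>i\<in>I. F i \<noteq> {}) \<and> disjoint_family_on F I \<and> (\<Union>i\<in>I. F i) = \<L> \<and>
     (\<forall>i\<in>I. \<forall>L\<in>F i. \<exists>S\<subseteq>L. finite S \<and> card S = d i \<and>
        (\<forall>L'\<in>(\<Union>j\<in>{j\<in>I. i \<le> j}. F j). S \<subseteq> L' \<longrightarrow> L = L'))"

definition teaching_order :: "nat set \<Rightarrow> (nat \<Rightarrow> nat) \<Rightarrow> enat" where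
  "teaching_order I d = (SUP i\<in>I. enat (d i))"

definition RTD_pos :: "nat set set \<Rightarrow> enat" where
  "RTD_pos \<L> = Inf {teaching_order I d | I F d. positive_teaching_seq \<L> I F d}"

definition uniformly_re_families :: "nat set \<Rightarrow> (nat \<Rightarrow> nat set set) \<Rightarrow> bool" where
  "uniformly_re_families I F \<longleftrightarrow>
     (\<exists>V. re_set V \<and>
        (\<forall>i\<in>I. F i = {{x. prod_encode (i, prod_encode (j, x)) \<in> V} | j. True}))"

text \<open>A witness is a uniformly r.e. sequence of finite order; its order need not attain
  the infimum \<^const>\<open>RTD_pos\<close>.\<close>

definition R_ure_pos :: "(nat \<Rightarrow> nat set) \<Rightarrow> nat set" where
  "R_ure_pos W =
     {e. RTD_pos (lang_family W e) < \<infinity> \<and>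
         (\<exists>I F d. positive_teaching_seq (lang_family W e) I F d \<and>
            teaching_order I d < \<infinity> \<and> uniformly_re_families I F)}"

end

theory Submission
  imports Defs
begin

text \<open>Write membership of \<open>x\<close> in a \<open>\<Sigma>\<^sup>0\<^sub>5\<close> set as \<open>\<exists>a. \<forall>b. \<exists>c. \<forall>t. B\<close> with \<open>B\<close> r.e., and let
  \<open>T k b c t\<close> be the r.e. condition \<open>\<exists>a\<le>k. \<forall>b'\<le>b. \<exists>c'\<le>c. \<forall>t'\<le>t. B\<close>. For every pair \<open>(k, b)\<close> a
  block of languages, indexed by the nodes of a tree, is placed on a column of its own. Every node
  owns infinitely many marks. The language of a child \<open>\<langle>c, t, D\<rangle>\<close> of \<open>p\<close>, where \<open>D\<close> has at most \<open>k\<close>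
  elements, all smaller than \<open>c\<close>, consists of its own marks and \<open>X \<inter> D\<close> for the language \<open>X\<close> of
  \<open>p\<close>. Once \<open>T k b c t\<close> is observed, the child collapses: its language becomes \<open>X\<close>, and its marks
  are put into all languages of the block.

  No \<open>D\<close> contains \<open>k + 1\<close> marks of a node, so \<open>k + 1\<close> marks always teach the language of an
  uncollapsed node. If \<open>T k b c t\<close> holds for all \<open>t\<close> and all large \<open>c\<close>, then the sets \<open>D\<close> of the
  uncollapsed nodes are jointly bounded and one large mark suffices. If for every \<open>c\<close> some
  \<open>T k b c t\<close> fails, then every subset of a language with at most \<open>k\<close> elements is the \<open>D\<close> of an
  uncollapsed child, so no language of the block has a teaching set of size \<open>k\<close>, not even the
  first one of the block in a teaching sequence. Hence a witness \<open>a\<close> yields a single layer taught by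
  sets of size \<open>a + 1\<close>, while without a witness every teaching sequence has infinite order.\<close>

section \<open>Recursive functions and semidecidable predicates\<close>

definition p1 :: "nat \<Rightarrow> nat" where "p1 z = fst (prod_decode z)"
definition p2 :: "nat \<Rightarrow> nat" where "p2 z = snd (prod_decode z)"

lemma p1_encode [simp]: "p1 (prod_encode (x, y)) = x" by (simp add: p1_def)
lemma p2_encode [simp]: "p2 (prod_encode (x, y)) = y" by (simp add: p2_def)
lemma encode_p1_p2 [simp]: "prod_encode (p1 z, p2 z) = z" by (simp add: p1_def p2_def)

lemma p1_le: "p1 z \<le> z"
  using le_prod_encode_1[of "p1 z" "p2 z"] by simp

definition recursive_fun2 :: "(nat \<Rightarrow> nat \<Rightarrow> nat) \<Rightarrow> bool" where
  "recursive_fun2 f \<longleftrightarrow> (\<exists>r. \<forall>x y. eval r [x, y] = Some (f x y))"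

lemma recursive_fun_id: "recursive_fun (\<lambda>x. x)"
  unfolding recursive_fun_def by (rule exI[of _ "Proj 0"]) simp

lemma recursive_fun_comp:
  assumes "recursive_fun f" "recursive_fun g"
  shows "recursive_fun (\<lambda>x. f (g x))"
proof -
  obtain r s where "\<forall>x. eval r [x] = Some (f x)" "\<forall>x. eval s [x] = Some (g x)"
    using assms unfolding recursive_fun_def by blast
  then have "\<forall>x. eval (Comp r [s]) [x] = Some (f (g x))" by simp
  then show ?thesis unfolding recursive_fun_def by blast
qed

lemma recursive_fun2_comp:
  assumes "recursive_fun2 f" "recursive_fun g" "recursive_fun h"
  shows "recursive_fun (\<lambda>x. f (g x) (h x))"
proof -
  obtain r s t where "\<forall>x y. eval r [x, y] = Some (f x y)"
    "\<forall>x. eval s [x] = Some (g x)" "\<forall>x. eval t [x] = Some (h x)"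
    using assms unfolding recursive_fun_def recursive_fun2_def by blast
  then have "\<forall>x. eval (Comp r [s, t]) [x] = Some (f (g x) (h x))" by simp
  then show ?thesis unfolding recursive_fun_def by blast
qed

lemma recursive_fun_Suc:
  assumes "recursive_fun f"
  shows "recursive_fun (\<lambda>x. Suc (f x))"
proof -
  have "recursive_fun Suc" unfolding recursive_fun_def by (rule exI[of _ Succ]) simp
  then show ?thesis using assms by (rule recursive_fun_comp)
qed

lemma recursive_fun_const: "recursive_fun (\<lambda>x. n)"
proof (induction n)
  case 0
  show ?case unfolding recursive_fun_def by (rule exI[of _ Zero]) simp
next
  case (Suc n)
  then show ?case by (rule recursive_fun_Suc)
qed

lemma recursive_fun2_add: "recursive_fun2 (+)"
proof -
  have "eval (PrimRec (Proj 0) (Comp Succ [Proj 1])) [x, y] = Some (x + y)" for x y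
    by (induction x) auto
  then show ?thesis unfolding recursive_fun2_def by blast
qed

lemma recursive_fun2_diff: "recursive_fun2 (-)"
proof -
  \<comment> \<open>Primitive recursion runs on the first argument, so \<open>r\<close> computes
    \<open>y - x\<close> by iterating the predecessor \<open>x\<close> times; the arguments are
    swapped afterwards.\<close>
  define r where "r = PrimRec (Proj 0) (Comp (PrimRec Zero (Proj 0)) [Proj 1])"
  have pr: "eval (PrimRec Zero (Proj 0)) [x] = Some (x - 1)" for x
    by (induction x) auto
  have "eval r [x, y] = Some (y - x)" for x y
  proof (induction x)
    case (Suc x)
    have "eval r [Suc x, y] = Option.bind (eval r [x, y])
        (\<lambda>v. eval (Comp (PrimRec Zero (Proj 0)) [Proj 1]) [x, v, y])"
      by (simp add: r_def)
    also have "\<dots> = eval (PrimRec Zero (Proj 0)) [y - x]" by (simp add: Suc)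
    finally show ?case by (simp only: pr) simp
  qed (simp add: r_def)
  then have "eval (Comp r [Proj 1, Proj 0]) [x, y] = Some (x - y)" for x y by simp
  then show ?thesis unfolding recursive_fun2_def by blast
qed

lemmas recursive_fun_add = recursive_fun2_comp[OF recursive_fun2_add]
lemmas recursive_fun_diff = recursive_fun2_comp[OF recursive_fun2_diff]

lemma recursive_fun_triangle: "recursive_fun triangle"
proof -
  obtain r where r: "\<And>x y. eval r [x, y] = Some (x + y)"
    using recursive_fun2_add unfolding recursive_fun2_def by blast
  have "eval (PrimRec Zero (Comp r [Comp Succ [Proj 0], Proj 1])) [x] = Some (triangle x)" for x
    by (induction x) (auto simp: r)
  then show ?thesis unfolding recursive_fun_def by blast
qed

lemma recursive_fun2_encode: "recursive_fun2 (\<lambda>x y. prod_encode (x, y))"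
proof -
  obtain r where r: "\<And>x y. eval r [x, y] = Some (x + y)"
    using recursive_fun2_add unfolding recursive_fun2_def by blast
  obtain s where s: "\<And>x. eval s [x] = Some (triangle x)"
    using recursive_fun_triangle unfolding recursive_fun_def by blast
  have "eval (Comp r [Comp s [r], Proj 0]) [x, y] = Some (prod_encode (x, y))" for x y
    by (auto simp: r s prod_encode_def)
  then show ?thesis unfolding recursive_fun2_def by blast
qed

lemmas recursive_fun_encode = recursive_fun2_comp[OF recursive_fun2_encode]

text \<open>The index of the Cantor diagonal through \<open>z\<close>, written as a least number so
  that \<open>Mu\<close> computes it.\<close>

definition diag_index :: "nat \<Rightarrow> nat" where
  "diag_index z = (LEAST s. z < triangle (Suc s))"

lemma diag_index_encode: "diag_index (prod_encode (x, y)) = x + y"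
  unfolding diag_index_def
proof (rule Least_equality)
  show "prod_encode (x, y) < triangle (Suc (x + y))"
    by (simp add: prod_encode_def)
next
  fix s assume s: "prod_encode (x, y) < triangle (Suc s)"
  show "x + y \<le> s"
  proof (rule ccontr)
    assume "\<not> x + y \<le> s"
    then have "triangle (Suc s) \<le> triangle (x + y)"
      unfolding triangle_def by (intro div_le_mono mult_le_mono) auto
    then show False using s by (simp add: prod_encode_def)
  qed
qed

lemma recursive_fun_diag_index: "recursive_fun diag_index"
proof -
  obtain r where r: "\<And>x y. eval r [x, y] = Some (x - y)"
    using recursive_fun2_diff unfolding recursive_fun2_def by blast
  obtain s where s: "\<And>x. eval s [x] = Some (triangle x)"
    using recursive_fun_triangle unfolding recursive_fun_def by blast
  \<comment> \<open>Truncated subtraction makes \<open>f\<close> vanish at \<open>n\<close> exactly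
    when \<open>z < triangle (Suc n)\<close>.\<close>
  define f where "f = Comp r [Comp Succ [Proj 1], Comp s [Comp Succ [Proj 0]]]"
  have f: "eval f [n, z] = Some (Suc z - triangle (Suc n))" for n z
    unfolding f_def by (auto simp: r s)
  have "z < triangle (Suc z)" for z by simp
  then have ex: "\<exists>n. eval f [n, z] = Some 0 \<and> (\<forall>m<n. eval f [m, z] \<noteq> None)" for z
    unfolding f by (intro exI[of _ z]) auto
  have "eval (Mu f) [z] = Some (diag_index z)" for z
  proof -
    have "eval (Mu f) [z] = Some (LEAST n. eval f [n, z] = Some 0)"
      using ex[of z] by simp
    also have "(\<lambda>n. eval f [n, z] = Some 0) = (\<lambda>n. z < triangle (Suc n))"
      unfolding f by (auto simp del: triangle_Suc)
    finally show ?thesis by (simp add: diag_index_def)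
  qed
  then show ?thesis unfolding recursive_fun_def by blast
qed

lemma recursive_fun_p1_p2: "recursive_fun p1" "recursive_fun p2"
proof -
  have 1: "p1 z = z - triangle (diag_index z)" and 2: "p2 z = diag_index z - p1 z" for z
  proof -
    obtain x y where "z = prod_encode (x, y)" by (metis encode_p1_p2)
    then show "p1 z = z - triangle (diag_index z)" "p2 z = diag_index z - p1 z"
      by (simp_all add: diag_index_encode) (simp add: prod_encode_def)
  qed
  have "recursive_fun (\<lambda>z. z - triangle (diag_index z))"
    by (intro recursive_fun_diff recursive_fun_id recursive_fun_diag_index
        recursive_fun_comp[OF recursive_fun_triangle])
  then show r1: "recursive_fun p1" by (simp add: 1[abs_def])
  have "recursive_fun (\<lambda>z. diag_index z - p1 z)"
    by (intro recursive_fun_diff r1 recursive_fun_diag_index)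
  then show "recursive_fun p2" by (simp add: 2[symmetric])
qed

lemmas recursive_fun_p1 = recursive_fun_comp[OF recursive_fun_p1_p2(1)]
lemmas recursive_fun_p2 = recursive_fun_comp[OF recursive_fun_p1_p2(2)]

text \<open>Parameter, counter and previous value are packed into one code, so that unary recursive
  functions suffice to express the recursion step.\<close>

lemma recursive_fun_rec_nat:
  assumes f: "recursive_fun f"
    and G: "recursive_fun (\<lambda>z. G (p1 (p1 z)) (p2 (p1 z)) (p2 z))"
    and n: "recursive_fun n"
  shows "recursive_fun (\<lambda>x. rec_nat (f x) (G x) (n x))"
proof -
  obtain rf rG rn where r: "\<And>x. eval rf [x] = Some (f x)" "\<And>x. eval rn [x] = Some (n x)"
      "\<And>z. eval rG [z] = Some (G (p1 (p1 z)) (p2 (p1 z)) (p2 z))"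
    using f G n unfolding recursive_fun_def by blast
  obtain pr where pr: "\<And>x y. eval pr [x, y] = Some (prod_encode (x, y))"
    using recursive_fun2_encode unfolding recursive_fun2_def by blast
  define g where "g = Comp rG [Comp pr [Comp pr [Proj 2, Proj 0], Proj 1]]"
  have g: "eval g [m, y, x] = Some (G x m y)" for m y x
    unfolding g_def by (simp add: r pr)
  have "eval (PrimRec rf g) [m, x] = Some (rec_nat (f x) (G x) m)" for m x
    by (induction m) (auto simp: r g)
  then have "eval (Comp (PrimRec rf g) [rn, Proj 0]) [x] = Some (rec_nat (f x) (G x) (n x))" for x
    by (simp add: r del: eval.simps(5))
  then show ?thesis unfolding recursive_fun_def by blast
qed

named_theorems recursive_intros

lemmas [recursive_intros] = recursive_fun_id recursive_fun_Suc recursive_fun_const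
  recursive_fun_add recursive_fun_diff recursive_fun_encode recursive_fun_p1 recursive_fun_p2

lemma recursive_fun_sum [recursive_intros]:
  assumes "recursive_fun (\<lambda>z. F (p1 z) (p2 z))" and "recursive_fun n"
  shows "recursive_fun (\<lambda>x. \<Sum>y<n x. F x y)"
proof -
  have "recursive_fun (\<lambda>x. rec_nat 0 (\<lambda>y r. r + F x y) (n x))"
    by (rule recursive_fun_rec_nat, rule recursive_fun_const, rule recursive_fun_add,
        rule recursive_fun_p2, rule recursive_fun_id,
        rule recursive_fun_comp[OF assms(1) recursive_fun_p1], rule recursive_fun_id, rule assms)
  moreover have "rec_nat 0 (\<lambda>y r. r + F x y) m = (\<Sum>y<m. F x y)" for x m
    by (induction m) auto
  ultimately show ?thesis by simp
qed

lemma recursive_fun_mult [recursive_intros]: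
  assumes "recursive_fun f" "recursive_fun g"
  shows "recursive_fun (\<lambda>x. f x * g x)"
proof -
  have "recursive_fun (\<lambda>x. \<Sum>y<f x. g x)"
    by (rule recursive_fun_sum, rule recursive_fun_comp[OF assms(2) recursive_fun_p1],
        rule recursive_fun_id, rule assms)
  then show ?thesis by simp
qed

lemma recursive_fun_mod2 [recursive_intros]:
  assumes "recursive_fun f"
  shows "recursive_fun (\<lambda>x. f x mod 2)"
proof -
  have "recursive_fun (\<lambda>x. rec_nat 0 (\<lambda>y r. 1 - r) (f x))"
    by (intro recursive_fun_rec_nat recursive_intros assms)
  moreover have "rec_nat 0 (\<lambda>y r. 1 - r) n = n mod 2" for n :: nat
    by (induction n) (auto, presburger+)
  ultimately show ?thesis by simp
qed

lemma recursive_fun_div2 [recursive_intros]: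
  assumes "recursive_fun f"
  shows "recursive_fun (\<lambda>x. f x div 2)"
proof -
  \<comment> \<open>There are \<open>n div 2\<close> odd numbers below \<open>n\<close>.\<close>
  have "recursive_fun (\<lambda>x. \<Sum>y<f x. y mod 2)"
    by (intro recursive_intros assms)
  moreover have "(\<Sum>y<n. y mod 2) = n div 2" for n :: nat
    by (induction n) (auto, presburger+)
  ultimately show ?thesis by simp
qed

lemma recursive_fun_div_power2 [recursive_intros]:
  assumes "recursive_fun f" "recursive_fun g"
  shows "recursive_fun (\<lambda>x. f x div 2 ^ g x)"
proof -
  have "recursive_fun (\<lambda>x. rec_nat (f x) (\<lambda>y r. r div 2) (g x))"
    by (intro recursive_fun_rec_nat recursive_intros assms)
  moreover have "rec_nat m (\<lambda>y r. r div 2) n = m div 2 ^ n" for m n :: nat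
    by (induction n) (auto simp: div_mult2_eq[symmetric] mult.commute)
  ultimately show ?thesis by simp
qed

section \<open>Decidable predicates and coded finite sets\<close>

definition decidable :: "(nat \<Rightarrow> bool) \<Rightarrow> bool" where
  "decidable P \<longleftrightarrow> recursive_fun (\<lambda>x. of_bool (P x))"

lemma decidable_comp: "decidable P \<Longrightarrow> recursive_fun f \<Longrightarrow> decidable (\<lambda>x. P (f x))"
  unfolding decidable_def by (rule recursive_fun_comp)

lemma decidable_le [recursive_intros]:
  assumes "recursive_fun f" "recursive_fun g"
  shows "decidable (\<lambda>x. f x \<le> g x)"
proof -
  have "recursive_fun (\<lambda>x. 1 - (f x - g x))" by (intro recursive_intros assms)
  moreover have "1 - (a - b) = of_bool (a \<le> b)" for a b :: nat by auto
  ultimately show ?thesis by (simp add: decidable_def)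
qed

lemma decidable_not [recursive_intros]:
  assumes "decidable P"
  shows "decidable (\<lambda>x. \<not> P x)"
proof -
  have "recursive_fun (\<lambda>x. 1 - of_bool (P x))"
    using assms unfolding decidable_def by (intro recursive_intros)
  moreover have "1 - of_bool (P x) = (of_bool (\<not> P x) :: nat)" for x by simp
  ultimately show ?thesis by (simp only: decidable_def)
qed

lemma decidable_conj [recursive_intros]:
  assumes "decidable P" "decidable Q"
  shows "decidable (\<lambda>x. P x \<and> Q x)"
proof -
  have "recursive_fun (\<lambda>x. of_bool (P x) * of_bool (Q x))"
    using assms unfolding decidable_def by (intro recursive_intros)
  then show ?thesis by (simp add: decidable_def of_bool_conj)
qed

lemma decidable_less [recursive_intros]:
  "recursive_fun f \<Longrightarrow> recursive_fun g \<Longrightarrow> decidable (\<lambda>x. f x < g x)"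
  unfolding not_le[symmetric] by (intro recursive_intros)

lemma decidable_eq [recursive_intros]:
  "recursive_fun f \<Longrightarrow> recursive_fun g \<Longrightarrow> decidable (\<lambda>x. f x = g x)"
  unfolding order_eq_iff by (intro recursive_intros)

lemma decidable_bex_less [recursive_intros]:
  assumes "decidable (\<lambda>z. P (p1 z) (p2 z))" "recursive_fun n"
  shows "decidable (\<lambda>x. \<exists>y<n x. P x y)"
proof -
  have "decidable (\<lambda>x. 1 \<le> (\<Sum>y<n x. of_bool (P x y) :: nat))"
    using assms(1) unfolding decidable_def[of "\<lambda>z. P (p1 z) (p2 z)"]
    by (intro recursive_intros assms)
  moreover have "1 \<le> (\<Sum>y<m. of_bool (P x y) :: nat) \<longleftrightarrow> (\<exists>y<m. P x y)" for x m
    by (induction m) (auto simp: less_Suc_eq)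
  ultimately show ?thesis by (simp add: Bex_def)
qed

lemma decidable_mem_set_decode [recursive_intros]:
  assumes "recursive_fun f" "recursive_fun g"
  shows "decidable (\<lambda>x. f x \<in> set_decode (g x))"
proof -
  have "decidable (\<lambda>x. g x div 2 ^ f x mod 2 = 1)" by (intro recursive_intros assms)
  then show ?thesis by (simp add: set_decode_def odd_iff_mod_2_eq_one)
qed

text \<open>Elements are positions of binary digits equal to 1, hence below the code. Bounds on
  codes thus bound the coded sets.\<close>

lemma set_decode_less: "x \<in> set_decode n \<Longrightarrow> x < n"
proof -
  assume "x \<in> set_decode n"
  then have "n div 2 ^ x \<noteq> 0" by (auto simp: set_decode_def intro: ccontr)
  then have "2 ^ x \<le> n" by (simp add: div_eq_0_iff)
  then show "x < n" using less_exp[of x] by (meson less_le_trans)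
qed

lemma recursive_fun_card_set_decode [recursive_intros]:
  assumes "recursive_fun f"
  shows "recursive_fun (\<lambda>x. card (set_decode (f x)))"
proof -
  have "decidable (\<lambda>z. p2 z \<in> set_decode (f (p1 z)))"
    by (intro recursive_intros recursive_fun_comp[OF assms])
  then have "recursive_fun (\<lambda>x. \<Sum>y<f x. of_bool (y \<in> set_decode (f x)))"
    unfolding decidable_def by (intro recursive_fun_sum assms)
  moreover have "(\<Sum>y<n. of_bool (y \<in> set_decode n)) = card (set_decode n)" for n
  proof -
    have "{..<n} \<inter> set_decode n = set_decode n" using set_decode_less by auto
    then show ?thesis by (simp add: sum_of_bool_eq)
  qed
  ultimately show ?thesis by simp
qed

section \<open>Semidecidable predicates as projections of decidable ones\<close>

definition semidecidable :: "(nat \<Rightarrow> bool) \<Rightarrow> bool" where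
  "semidecidable P \<longleftrightarrow> (\<exists>Q. decidable Q \<and> (\<forall>x. P x \<longleftrightarrow> (\<exists>y. Q (prod_encode (x, y)))))"

lemma re_set_semidecidable:
  assumes "semidecidable P"
  shows "re_set {x. P x}"
proof -
  obtain Q where Q: "decidable Q" and P: "\<And>x. P x \<longleftrightarrow> (\<exists>y. Q (prod_encode (x, y)))"
    using assms unfolding semidecidable_def by blast
  \<comment> \<open>\<open>Mu\<close> looks for a zero, so the indicator is negated; as it is total,
    the search halts exactly when a witness exists.\<close>
  obtain r where r: "\<And>z. eval r [z] = Some (of_bool (\<not> Q z))"
    using decidable_not[OF Q] unfolding decidable_def recursive_fun_def by blast
  obtain pr where pr: "\<And>x y. eval pr [x, y] = Some (prod_encode (x, y))"
    using recursive_fun2_encode unfolding recursive_fun2_def by blast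
  define f where "f = Comp r [Comp pr [Proj 1, Proj 0]]"
  have f: "eval f [n, x] = Some (of_bool (\<not> Q (prod_encode (x, n))))" for n x
    unfolding f_def by (simp add: r pr)
  have "eval (Mu f) [x] \<noteq> None \<longleftrightarrow> P x" for x
    by (simp add: f P)
  then show ?thesis unfolding re_set_def by (intro exI[of _ "Mu f"]) simp
qed

lemma semidecidable_comp:
  assumes "semidecidable P" "recursive_fun f"
  shows "semidecidable (\<lambda>x. P (f x))"
proof -
  obtain Q where Q: "decidable Q" and P: "\<And>x. P x \<longleftrightarrow> (\<exists>y. Q (prod_encode (x, y)))"
    using assms unfolding semidecidable_def by blast
  have "decidable (\<lambda>z. Q (prod_encode (f (p1 z), p2 z)))"
    by (intro decidable_comp[OF Q] recursive_intros recursive_fun_comp[OF assms(2)])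
  then show ?thesis unfolding semidecidable_def P
    by (intro exI[of _ "\<lambda>z. Q (prod_encode (f (p1 z), p2 z))"]) simp
qed

lemma semidecidable_decidable:
  assumes "decidable P"
  shows "semidecidable P"
proof -
  have "decidable (\<lambda>z. P (p1 z))" by (intro decidable_comp[OF assms] recursive_intros)
  then show ?thesis unfolding semidecidable_def by (intro exI[of _ "\<lambda>z. P (p1 z)"]) simp
qed

lemma semidecidable_ex [recursive_intros]:
  assumes "semidecidable (\<lambda>z. P (p1 z) (p2 z))"
  shows "semidecidable (\<lambda>x. \<exists>y. P x y)"
proof -
  obtain Q where Q: "decidable Q"
      and P: "\<And>x. P (p1 x) (p2 x) \<longleftrightarrow> (\<exists>y. Q (prod_encode (x, y)))"
    using assms unfolding semidecidable_def by blast
  have P': "P x y \<longleftrightarrow> (\<exists>w. Q (prod_encode (prod_encode (x, y), w)))" for x y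
    using P[of "prod_encode (x, y)"] by simp
  \<comment> \<open>The quantified value and the witness for \<open>Q\<close> are merged into one
    pair.\<close>
  define Q' where "Q' z = Q (prod_encode (prod_encode (p1 z, p1 (p2 z)), p2 (p2 z)))" for z
  have "decidable Q'" unfolding Q'_def by (intro decidable_comp[OF Q] recursive_intros)
  moreover have "(\<exists>y. P x y) \<longleftrightarrow> (\<exists>v. Q' (prod_encode (x, v)))" for x
  proof
    assume "\<exists>y. P x y"
    then obtain y w where "Q (prod_encode (prod_encode (x, y), w))" using P' by blast
    then have "Q' (prod_encode (x, prod_encode (y, w)))" by (simp add: Q'_def)
    then show "\<exists>v. Q' (prod_encode (x, v))" by blast
  qed (auto simp: Q'_def P')
  ultimately show ?thesis unfolding semidecidable_def by blast
qed

lemma semidecidable_conj [recursive_intros]: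
  assumes "semidecidable P" "semidecidable P'"
  shows "semidecidable (\<lambda>x. P x \<and> P' x)"
proof -
  obtain Q where Q: "decidable Q" and P: "\<And>x. P x \<longleftrightarrow> (\<exists>y. Q (prod_encode (x, y)))"
    using assms unfolding semidecidable_def by blast
  obtain Q' where Q': "decidable Q'" and P': "\<And>x. P' x \<longleftrightarrow> (\<exists>y. Q' (prod_encode (x, y)))"
    using assms unfolding semidecidable_def by blast
  have "semidecidable (\<lambda>x. \<exists>y y'. Q (prod_encode (x, y)) \<and> Q' (prod_encode (x, y')))"
    by (intro semidecidable_ex semidecidable_decidable decidable_conj decidable_comp[OF Q]
        decidable_comp[OF Q'] recursive_intros)
  then show ?thesis by (simp add: P P')
qed

lemma semidecidable_disj [recursive_intros]:
  assumes "semidecidable P" "semidecidable P'"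
  shows "semidecidable (\<lambda>x. P x \<or> P' x)"
proof -
  obtain Q where Q: "decidable Q" and P: "\<And>x. P x \<longleftrightarrow> (\<exists>y. Q (prod_encode (x, y)))"
    using assms unfolding semidecidable_def by blast
  obtain Q' where Q': "decidable Q'" and P': "\<And>x. P' x \<longleftrightarrow> (\<exists>y. Q' (prod_encode (x, y)))"
    using assms unfolding semidecidable_def by blast
  have "decidable (\<lambda>z. \<not> (\<not> Q z \<and> \<not> Q' z))"
    by (intro decidable_not decidable_conj Q Q')
  then show ?thesis unfolding semidecidable_def P P'
    by (intro exI[of _ "\<lambda>z. \<not> (\<not> Q z \<and> \<not> Q' z)"]) auto
qed

lemma semidecidable_bex [recursive_intros]:
  assumes "semidecidable (\<lambda>z. P (p1 z) (p2 z))" "recursive_fun n"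
  shows "semidecidable (\<lambda>x. \<exists>y\<le>n x. P x y)"
  by (intro semidecidable_ex semidecidable_conj assms semidecidable_decidable decidable_le
      recursive_fun_comp[OF assms(2)] recursive_intros)

text \<open>A bounded universal quantifier commutes with the search for witnesses, because
  finitely many witnesses have a common bound.\<close>

lemma semidecidable_ball [recursive_intros]:
  assumes "semidecidable (\<lambda>z. P (p1 z) (p2 z))" "recursive_fun n"
  shows "semidecidable (\<lambda>x. \<forall>y\<le>n x. P x y)"
proof -
  obtain Q where Q: "decidable Q"
      and P: "\<And>x. P (p1 x) (p2 x) \<longleftrightarrow> (\<exists>y. Q (prod_encode (x, y)))"
    using assms unfolding semidecidable_def by blast
  have P': "P x y \<longleftrightarrow> (\<exists>w. Q (prod_encode (prod_encode (x, y), w)))" for x y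
    using P[of "prod_encode (x, y)"] by simp
  have eq: "(\<forall>y\<le>n x. P x y) \<longleftrightarrow>
      (\<exists>W. \<not> (\<exists>y<Suc (n x). \<not> (\<exists>w<W. Q (prod_encode (prod_encode (x, y), w)))))" for x
  proof
    assume "\<forall>y\<le>n x. P x y"
    then obtain w where w: "\<And>y. y \<le> n x \<Longrightarrow> Q (prod_encode (prod_encode (x, y), w y))"
      unfolding P' by metis
    have "w y < Suc (\<Sum>y\<le>n x. w y)" if "y \<le> n x" for y
      using that by (simp add: less_Suc_eq_le member_le_sum)
    then show "\<exists>W. \<not> (\<exists>y<Suc (n x). \<not> (\<exists>w<W. Q (prod_encode (prod_encode (x, y), w))))"
      using w by (intro exI[of _ "Suc (\<Sum>y\<le>n x. w y)"]) (auto simp: less_Suc_eq_le)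
  qed (auto simp: P' less_Suc_eq_le)
  show ?thesis unfolding eq
    by (intro semidecidable_ex semidecidable_decidable decidable_not decidable_bex_less
        decidable_comp[OF Q] recursive_fun_comp[OF assms(2)] recursive_intros)
qed

text \<open>Nested to the left, because each level of \<open>arith_Sigma\<close> pairs its new
  variable on the right.\<close>

abbreviation tuple5 :: "nat \<Rightarrow> nat \<Rightarrow> nat \<Rightarrow> nat \<Rightarrow> nat \<Rightarrow> nat" where
  "tuple5 x a b c t \<equiv> prod_encode (prod_encode (prod_encode (prod_encode (x, a), b), c), t)"

text \<open>The innermost of the five quantifiers is existential and is absorbed into the
  semidecidable matrix, which leaves four.\<close>

lemma arith_Sigma_5:
  assumes "arith_Sigma 5 A"
  shows "\<exists>B. semidecidable B \<and> (\<forall>x. x \<in> A \<longleftrightarrow> (\<exists>a. \<forall>b. \<exists>c. \<forall>t.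
    B (tuple5 x a b c t)))"
proof -
  have "5 = Suc (Suc (Suc (Suc (Suc 0))))" by simp
  with assms have "arith_Sigma (Suc (Suc (Suc (Suc (Suc 0))))) A" by metis
  then obtain B1 B2 B3 B4 B5 where B5: "recursive_set (- B5)"
    and A: "A = {x. \<exists>y. prod_encode (x, y) \<in> B1}"
    and B: "- B1 = {x. \<exists>y. prod_encode (x, y) \<in> B2}" "- B2 = {x. \<exists>y. prod_encode (x, y) \<in> B3}"
      "- B3 = {x. \<exists>y. prod_encode (x, y) \<in> B4}" "- B4 = {x. \<exists>y. prod_encode (x, y) \<in> B5}"
    unfolding arith_Sigma.simps by blast
  obtain f where f: "recursive_fun f" "\<And>x. f x = of_bool (x \<in> - B5)"
    using B5 unfolding recursive_set_def by (auto simp: of_bool_def)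
  have "decidable (\<lambda>x. x \<in> - B5)"
    unfolding decidable_def f(2)[symmetric] using f(1) by simp
  then have "decidable (\<lambda>x. x \<in> B5)" using decidable_not by fastforce
  then have "semidecidable (\<lambda>x. \<exists>y. prod_encode (x, y) \<in> B5)"
    by (intro semidecidable_ex semidecidable_decidable) simp
  then have "semidecidable (\<lambda>x. x \<in> - B4)" unfolding B by simp
  moreover have "x \<in> A \<longleftrightarrow> (\<exists>a. \<forall>b. \<exists>c. \<forall>t.
    tuple5 x a b c t \<in> - B4)" for x
  proof -
    have "\<And>z. z \<in> B1 \<longleftrightarrow> (\<forall>y. prod_encode (z, y) \<notin> B2)" "\<And>z. z \<notin> B2 \<longleftrightarrow> (\<exists>y. prod_encode (z, y) \<in> B3)"
      "\<And>z. z \<in> B3 \<longleftrightarrow> (\<forall>y. prod_encode (z, y) \<notin> B4)"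
      using B by blast+
    then show ?thesis by (simp add: A)
  qed
  ultimately show ?thesis by blast
qed

section \<open>The languages of a block\<close>

text \<open>A node is \<open>0\<close> or a child \<open>Suc \<langle>p, \<langle>\<langle>c, t\<rangle>, D\<rangle>\<rangle>\<close> of \<open>p\<close>; here \<open>D\<close> codes a finite set.\<close>

definition parent :: "nat \<Rightarrow> nat" where "parent q = p1 (q - 1)"
definition node_c :: "nat \<Rightarrow> nat" where "node_c q = p1 (p1 (p2 (q - 1)))"
definition node_t :: "nat \<Rightarrow> nat" where "node_t q = p2 (p1 (p2 (q - 1)))"
definition node_D :: "nat \<Rightarrow> nat" where "node_D q = p2 (p2 (q - 1))"

lemma parent_less: "q \<noteq> 0 \<Longrightarrow> parent q < q"
  unfolding parent_def using p1_le[of "q - 1"] by linarith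

text \<open>The root never collapses. For an uncollapsed child, \<open>c\<close> exceeds the code of
  \<open>D\<close> and therefore also all elements of \<open>D\<close>.\<close>

definition collapsed :: "nat \<Rightarrow> (nat \<Rightarrow> nat \<Rightarrow> bool) \<Rightarrow> nat \<Rightarrow> bool" where
  "collapsed k T q \<longleftrightarrow> q \<noteq> 0 \<and>
     (node_c q \<le> node_D q \<or> k < card (set_decode (node_D q)) \<or> T (node_c q) (node_t q))"

text \<open>The elements \<open>\<langle>p, n\<rangle>\<close> are the marks of the node \<open>p\<close>. Nodes with an unsuitable \<open>D\<close> count as
  collapsed.\<close>

inductive in_node :: "nat \<Rightarrow> (nat \<Rightarrow> nat \<Rightarrow> bool) \<Rightarrow> nat \<Rightarrow> nat \<Rightarrow> bool" for k T y where
  junk: "collapsed k T (p1 y) \<Longrightarrow> in_node k T y q"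
| mark: "p1 y = q \<Longrightarrow> in_node k T y q"
| step: "q \<noteq> 0 \<Longrightarrow> in_node k T y (parent q) \<Longrightarrow> collapsed k T q \<or> y \<in> set_decode (node_D q)
    \<Longrightarrow> in_node k T y q"

definition node_lang :: "nat \<Rightarrow> (nat \<Rightarrow> nat \<Rightarrow> bool) \<Rightarrow> nat \<Rightarrow> nat set" where
  "node_lang k T q = {y. in_node k T y q}"

text \<open>The marks of a collapsed node lie in all languages of the block, so they add nothing to
  what comes from the parent.\<close>

lemma node_lang_collapsed:
  assumes "collapsed k T q"
  shows "node_lang k T q = node_lang k T (parent q)"
proof -
  have "q \<noteq> 0" using assms by (simp add: collapsed_def)
  then show ?thesis
    using assms by (auto simp: node_lang_def intro: in_node.intros elim: in_node.cases)
qed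

text \<open>Passing from collapsed nodes to their parents ends at the root at the latest.
  Uncollapsed nodes therefore represent all languages.\<close>

lemma node_lang_uncollapsed:
  "\<exists>p. \<not> collapsed k T p \<and> node_lang k T q = node_lang k T p"
proof (induction q rule: less_induct)
  case (less q)
  show ?case
  proof (cases "collapsed k T q")
    case True
    then have "q \<noteq> 0" by (simp add: collapsed_def)
    then show ?thesis using less[OF parent_less] node_lang_collapsed[OF True] by simp
  qed blast
qed

text \<open>The clauses \<open>junk\<close> and \<open>mark\<close> are excluded, and
  \<open>step\<close> at an uncollapsed node lets only elements of \<open>D\<close> through.\<close>

lemma foreign_marks:
  assumes "\<not> collapsed k T p" "\<not> collapsed k T q" "p \<noteq> q"
    and "prod_encode (p, n) \<in> node_lang k T q"
  shows "q \<noteq> 0" "prod_encode (p, n) \<in> set_decode (node_D q)"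
  using assms by (auto simp: node_lang_def elim: in_node.cases)

lemma own_mark: "prod_encode (q, n) \<in> node_lang k T q"
  by (simp add: node_lang_def in_node.mark)

text \<open>Otherwise the infinitely many marks of \<open>p\<close> would all lie in the finite set
  \<open>D\<close> of \<open>q\<close>.\<close>

lemma node_lang_inject:
  assumes "\<not> collapsed k T p" "\<not> collapsed k T q" "node_lang k T p = node_lang k T q"
  shows "p = q"
proof (rule ccontr)
  assume "p \<noteq> q"
  then have "prod_encode (p, n) \<in> set_decode (node_D q)" for n
    using foreign_marks[OF assms(1,2)] own_mark assms(3) by metis
  then have "range (\<lambda>n. prod_encode (p, n)) \<subseteq> set_decode (node_D q)" by auto
  then have "finite (range (\<lambda>n. prod_encode (p, n)))" by (rule finite_subset) simp
  then have "finite (UNIV :: nat set)" by (rule finite_imageD) (simp add: inj_on_def)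
  then show False by simp
qed

lemma node_lang_teachable:
  assumes k: "k \<le> a \<or> (\<forall>c t. e \<le> c \<longrightarrow> T c t)"
  shows "\<exists>S\<subseteq>node_lang k T q. finite S \<and> card S = Suc a \<and>
    (\<forall>q'. S \<subseteq> node_lang k T q' \<longrightarrow> node_lang k T q = node_lang k T q')"
proof -
  obtain p where p: "\<not> collapsed k T p" "node_lang k T q = node_lang k T p"
    using node_lang_uncollapsed by blast
  \<comment> \<open>One set serves both alternatives: its size defeats every \<open>D\<close> if
    \<open>k \<le> a\<close>, and its marks, numbered from \<open>e\<close> on, are too large for
    \<open>D\<close> in the other case.\<close>
  define S where "S = (\<lambda>n. prod_encode (p, n)) ` {e..e + a}"
  have S: "finite S" "card S = Suc a" unfolding S_def
    by (auto simp: card_image inj_on_def)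
  have "node_lang k T p = node_lang k T q'" if sub: "S \<subseteq> node_lang k T q'" for q'
  proof -
    obtain r where r: "\<not> collapsed k T r" "node_lang k T q' = node_lang k T r"
      using node_lang_uncollapsed by blast
    have "p = r"
    proof (rule ccontr)
      assume "p \<noteq> r"
      note foreign = foreign_marks[OF p(1) r(1) \<open>p \<noteq> r\<close>]
      have D: "S \<subseteq> set_decode (node_D r)"
        using foreign(2) sub r(2) unfolding S_def by auto
      have "prod_encode (p, e) \<in> node_lang k T r"
        using sub r(2) unfolding S_def by auto
      then have "r \<noteq> 0" by (rule foreign(1))
      then have nc: "node_D r < node_c r" "card (set_decode (node_D r)) \<le> k"
          "\<not> T (node_c r) (node_t r)"
        using r(1) by (auto simp: collapsed_def)
      have "Suc a \<le> card (set_decode (node_D r))"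
        using card_mono[OF _ D] S by simp
      then have "\<not> k \<le> a" using nc by simp
      \<comment> \<open>In the second alternative every child with \<open>c \<ge> e\<close>
        collapses. So \<open>c\<close> is below \<open>e\<close> here, while the mark numbered
        \<open>e\<close> lies in \<open>D\<close>, whose code is below \<open>c\<close>.\<close>
      then have "node_c r < e" using k nc by (meson not_le)
      moreover have "prod_encode (p, e) \<in> set_decode (node_D r)"
        using D by (auto simp: S_def)
      then have "prod_encode (p, e) < node_D r" by (rule set_decode_less)
      then have "e < node_D r" using le_prod_encode_2[of e p] by simp
      ultimately show False using nc by simp
    qed
    then show ?thesis using r by simp
  qed
  moreover have "S \<subseteq> node_lang k T p" unfolding S_def using own_mark by auto
  ultimately show ?thesis using S p by metis
qed

text \<open>The competitor is a child of \<open>p\<close> with \<open>D = S\<close>, which keeps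
  \<open>S\<close> and differs from \<open>p\<close> as an uncollapsed node.\<close>

lemma node_lang_not_teachable:
  assumes T: "\<forall>c. \<exists>t. \<not> T c t"
    and S: "S \<subseteq> node_lang k T q" "finite S" "card S \<le> k"
  shows "\<exists>q'. S \<subseteq> node_lang k T q' \<and> node_lang k T q \<noteq> node_lang k T q'"
proof -
  obtain p where p: "\<not> collapsed k T p" "node_lang k T q = node_lang k T p"
    using node_lang_uncollapsed by blast
  define D where "D = set_encode S"
  have D: "set_decode D = S" using S by (simp add: D_def)
  \<comment> \<open>\<open>Suc D\<close> is the least \<open>c\<close> that admits the code
    \<open>D\<close>; the choice of \<open>t\<close> keeps the test from ever succeeding.\<close>
  obtain t where t: "\<not> T (Suc D) t" using T by blast
  define r where "r = Suc (prod_encode (p, prod_encode (prod_encode (Suc D, t), D)))"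
  have r: "r \<noteq> 0" "parent r = p" "node_c r = Suc D" "node_t r = t" "node_D r = D"
    by (simp_all add: r_def parent_def node_c_def node_t_def node_D_def)
  have "\<not> collapsed k T r" using r t D S by (simp add: collapsed_def)
  moreover have "p \<noteq> r" using parent_less[OF r(1)] unfolding r(2) by blast
  moreover have "S \<subseteq> node_lang k T r"
  proof
    fix y assume "y \<in> S"
    then have "in_node k T y (parent r)" "y \<in> set_decode (node_D r)"
      using S(1) p(2) r D by (auto simp: node_lang_def)
    then show "y \<in> node_lang k T r"
      using in_node.step[OF r(1)] by (simp add: node_lang_def)
  qed
  ultimately show ?thesis using node_lang_inject p by metis
qed

text \<open>The finite set coded by \<open>w\<close> certifies that \<open>y\<close> belongs to the languages of its nodes up to
  \<open>q\<close>: parents precede their children, so the justifications are well-founded.\<close>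

definition derivation :: "nat \<Rightarrow> (nat \<Rightarrow> nat \<Rightarrow> bool) \<Rightarrow> nat \<Rightarrow> nat \<Rightarrow> nat \<Rightarrow> bool" where
  "derivation k T y q w \<longleftrightarrow> (\<forall>r\<le>q. r \<notin> set_decode w \<or> collapsed k T (p1 y) \<or> p1 y = r \<or>
     0 < r \<and> parent r \<in> set_decode w \<and> (collapsed k T r \<or> y \<in> set_decode (node_D r)))"

lemma derivationD:
  assumes "derivation k T y q w" "r \<le> q" "r \<in> set_decode w"
  shows "in_node k T y r"
  using assms(2,3)
proof (induction r rule: less_induct)
  case (less r)
  then consider "collapsed k T (p1 y)" | "p1 y = r" |
    "0 < r" "parent r \<in> set_decode w" "collapsed k T r \<or> y \<in> set_decode (node_D r)"
    using assms(1)[unfolded derivation_def, rule_format, of r] by argo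
  then show ?case
  proof cases
    case 3
    then have "parent r < r" using parent_less by simp
    then have "in_node k T y (parent r)" using less 3 by simp
    then show ?thesis using 3 by (simp add: in_node.step[of r])
  qed (simp_all add: in_node.junk in_node.mark)
qed

text \<open>The set of all nodes up to \<open>q\<close> whose languages contain \<open>y\<close>
  certifies itself, since it is closed under the parents used by \<open>step\<close>.\<close>

lemma derivation_exists:
  "derivation k T y q (set_encode {r. r \<le> q \<and> in_node k T y r})"
  unfolding derivation_def
proof (intro allI impI)
  fix r assume "r \<le> q"
  have w: "set_decode (set_encode {r. r \<le> q \<and> in_node k T y r}) = {r. r \<le> q \<and> in_node k T y r}"
    by simp
  show "r \<notin> set_decode (set_encode {r. r \<le> q \<and> in_node k T y r}) \<or> collapsed k T (p1 y) \<or>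
      p1 y = r \<or> 0 < r \<and> parent r \<in> set_decode (set_encode {r. r \<le> q \<and> in_node k T y r}) \<and>
      (collapsed k T r \<or> y \<in> set_decode (node_D r))"
  proof (cases "in_node k T y r")
    case True
    then show ?thesis
    proof cases
      case step
      then have "parent r \<le> q" using parent_less[of r] \<open>r \<le> q\<close> by simp
      with step show ?thesis unfolding w by simp
    qed simp_all
  qed simp
qed

text \<open>This replaces the inductive definition by a search for a code followed by a bounded
  check, which is visibly semidecidable.\<close>

lemma in_node_iff: "in_node k T y q \<longleftrightarrow> (\<exists>w. q \<in> set_decode w \<and> derivation k T y q w)"
proof
  assume "in_node k T y q"
  then have "q \<in> set_decode (set_encode {r. r \<le> q \<and> in_node k T y r})" by simp
  then show "\<exists>w. q \<in> set_decode w \<and> derivation k T y q w" using derivation_exists by blast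
qed (auto intro: derivationD)

section \<open>Bounded tests: a larger \<open>k\<close> or \<open>c\<close> makes them easier, a
  larger \<open>b\<close> or \<open>t\<close> harder\<close>

definition monotone_test :: "(nat \<Rightarrow> bool) \<Rightarrow> nat \<Rightarrow> nat \<Rightarrow> nat \<Rightarrow> nat \<Rightarrow> nat \<Rightarrow> bool" where
  "monotone_test B x k b c t \<longleftrightarrow> (\<exists>a\<le>k. \<forall>b'\<le>b. \<exists>c'\<le>c. \<forall>t'\<le>t.
    B (tuple5 x a b' c' t'))"

text \<open>For fixed \<open>b\<close> only the finitely many values \<open>g b'\<close> with
  \<open>b' \<le> b\<close> matter, and their sum bounds them all, independently of
  \<open>t\<close>.\<close>

lemma monotone_test_total:
  assumes "\<forall>b. \<exists>c. \<forall>t. B (tuple5 x a b c t)"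
    and "a \<le> k"
  shows "\<exists>e. \<forall>c t. e \<le> c \<longrightarrow> monotone_test B x k b c t"
proof -
  obtain g where g: "\<And>b t. B (tuple5 x a b (g b) t)"
    using assms(1) by metis
  have "monotone_test B x k b c t" if "(\<Sum>b'\<le>b. g b') \<le> c" for c t
  proof -
    have "g b' \<le> c" if "b' \<le> b" for b'
      using that \<open>(\<Sum>b'\<le>b. g b') \<le> c\<close> member_le_sum[of b' "{..b}" g] by simp
    then show ?thesis unfolding monotone_test_def using g assms(2) by blast
  qed
  then show ?thesis by blast
qed

text \<open>Each \<open>a \<le> k\<close> is refuted at some \<open>g a\<close>, where each
  \<open>c' \<le> c\<close> fails at some \<open>h a c'\<close>. Sums give common bounds, and the
  one for \<open>b\<close> does not depend on \<open>c\<close>.\<close>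

lemma monotone_test_fails:
  assumes "\<forall>a. \<exists>b. \<forall>c. \<exists>t. \<not> B (tuple5 x a b c t)"
  shows "\<exists>b. \<forall>c. \<exists>t. \<not> monotone_test B x k b c t"
proof -
  obtain g h where gh: "\<And>a c. \<not> B (tuple5 x a (g a) c (h a c))"
    using assms by metis
  let ?t = "\<lambda>c. \<Sum>(a, c')\<in>{..k} \<times> {..c}. h a c'"
  have "\<not> monotone_test B x k (\<Sum>a\<le>k. g a) c (?t c)" for c
  proof
    assume "monotone_test B x k (\<Sum>a\<le>k. g a) c (?t c)"
    then obtain a where a: "a \<le> k"
      and *: "\<And>b'. b' \<le> (\<Sum>a\<le>k. g a) \<Longrightarrow> \<exists>c'\<le>c. \<forall>t'\<le>?t c.
        B (tuple5 x a b' c' t')"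
      unfolding monotone_test_def by blast
    have "g a \<le> (\<Sum>a\<le>k. g a)" using a by (simp add: member_le_sum)
    from *[OF this] obtain c' where c': "c' \<le> c" and
      **: "\<And>t'. t' \<le> ?t c \<Longrightarrow>
        B (tuple5 x a (g a) c' t')" by blast
    have "(\<lambda>(a, c'). h a c') (a, c') \<le> ?t c"
      by (rule member_le_sum) (use a c' in auto)
    then have "B (tuple5 x a (g a) c' (h a c'))"
      by (intro **) simp
    with gh show False by blast
  qed
  then show ?thesis by blast
qed

section \<open>The reduction\<close>

text \<open>Block \<open>\<langle>k, b\<rangle>\<close> lives on its own column of the naturals.\<close>

definition block_lang :: "(nat \<Rightarrow> bool) \<Rightarrow> nat \<Rightarrow> nat \<Rightarrow> nat set" where
  "block_lang B x j = {y. p1 y = p1 j \<and>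
     in_node (p1 (p1 j)) (monotone_test B x (p1 (p1 j)) (p2 (p1 j))) (p2 y) (p2 j)}"

section \<open>Uniform enumerability of the block languages\<close>

lemma recursive_fun_node [recursive_intros]:
  assumes "recursive_fun f"
  shows "recursive_fun (\<lambda>x. parent (f x))" "recursive_fun (\<lambda>x. node_c (f x))"
    "recursive_fun (\<lambda>x. node_t (f x))" "recursive_fun (\<lambda>x. node_D (f x))"
  unfolding parent_def node_c_def node_t_def node_D_def by (intro recursive_intros assms)+

lemma semidecidable_monotone_test:
  assumes B: "semidecidable B" and f: "recursive_fun x" "recursive_fun k" "recursive_fun b"
      "recursive_fun c" "recursive_fun t"
  shows "semidecidable (\<lambda>z. monotone_test B (x z) (k z) (b z) (c z) (t z))"
  unfolding monotone_test_def
  by (intro semidecidable_bex semidecidable_ball semidecidable_comp[OF B] recursive_intros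
      f[THEN recursive_fun_comp] f)

lemma semidecidable_collapsed:
  assumes B: "semidecidable B" and f: "recursive_fun x" "recursive_fun k" "recursive_fun b"
      "recursive_fun q"
  shows "semidecidable (\<lambda>z. collapsed (k z) (monotone_test B (x z) (k z) (b z)) (q z))"
  unfolding collapsed_def
  by (intro semidecidable_conj semidecidable_disj semidecidable_monotone_test B
      semidecidable_decidable[OF decidable_not] semidecidable_decidable[OF decidable_less]
      semidecidable_decidable[OF decidable_le] decidable_eq recursive_intros f)

lemma semidecidable_in_node:
  assumes B: "semidecidable B" and f: "recursive_fun x" "recursive_fun k" "recursive_fun b"
      "recursive_fun y" "recursive_fun q"
  shows "semidecidable (\<lambda>z. in_node (k z) (monotone_test B (x z) (k z) (b z)) (y z) (q z))"
  unfolding in_node_iff derivation_def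
  by (intro semidecidable_ex semidecidable_conj semidecidable_disj semidecidable_ball
      semidecidable_collapsed B
      semidecidable_decidable[OF decidable_not] semidecidable_decidable[OF decidable_less]
      semidecidable_decidable[OF decidable_eq] semidecidable_decidable[OF decidable_mem_set_decode]
      decidable_mem_set_decode recursive_intros f f[THEN recursive_fun_comp])

lemma uniformly_re_block_lang:
  assumes "semidecidable B"
  shows "uniformly_re (\<lambda>x. {prod_encode (j, y) | j y. y \<in> block_lang B x j})"
proof -
  have "semidecidable (\<lambda>z. p2 (p2 z) \<in> block_lang B (p1 z) (p1 (p2 z)))"
    unfolding block_lang_def mem_Collect_eq
    by (intro semidecidable_conj semidecidable_in_node assms
        semidecidable_decidable[OF decidable_eq] recursive_intros)
  then have "re_set {z. p2 (p2 z) \<in> block_lang B (p1 z) (p1 (p2 z))}"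
    by (rule re_set_semidecidable)
  also have "{z. p2 (p2 z) \<in> block_lang B (p1 z) (p1 (p2 z))} =
      {prod_encode (x, u) | x u. u \<in> {prod_encode (j, y) | j y. y \<in> block_lang B x j}}"
  proof (intro subset_antisym subsetI)
    fix z assume "z \<in> {z. p2 (p2 z) \<in> block_lang B (p1 z) (p1 (p2 z))}"
    moreover have "z = prod_encode (p1 z, prod_encode (p1 (p2 z), p2 (p2 z)))" by simp
    ultimately show "z \<in> {prod_encode (x, u) | x u. u \<in> {prod_encode (j, y) | j y. y \<in> block_lang B x j}}"
      by blast
  qed auto
  finally show ?thesis unfolding uniformly_re_def .
qed

section \<open>Teaching sets for the languages of all blocks\<close>

lemma block_lang_eq:
  "block_lang B x j = (\<lambda>y. prod_encode (p1 j, y)) `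
     node_lang (p1 (p1 j)) (monotone_test B x (p1 (p1 j)) (p2 (p1 j))) (p2 j)"
proof (intro subset_antisym subsetI)
  fix y assume y: "y \<in> block_lang B x j"
  then have "y = prod_encode (p1 j, p2 y)" by (metis (mono_tags) block_lang_def encode_p1_p2 mem_Collect_eq)
  with y show "y \<in> (\<lambda>y. prod_encode (p1 j, y)) `
     node_lang (p1 (p1 j)) (monotone_test B x (p1 (p1 j)) (p2 (p1 j))) (p2 j)"
    by (auto simp: block_lang_def node_lang_def)
qed (auto simp: block_lang_def node_lang_def)

lemma block_lang_teachable:
  assumes "\<forall>b. \<exists>c. \<forall>t. B (tuple5 x a b c t)"
  shows "\<exists>S\<subseteq>block_lang B x j. finite S \<and> card S = Suc a \<and>
    (\<forall>j'. S \<subseteq> block_lang B x j' \<longrightarrow> block_lang B x j = block_lang B x j')"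
proof -
  define k where "k = p1 (p1 j)"
  define T where "T = monotone_test B x k (p2 (p1 j))"
  \<comment> \<open>If \<open>k \<le> a\<close> fails, then \<open>a\<close> is among the witnesses
    that the test of the block may use.\<close>
  obtain e where e: "k \<le> a \<or> (\<forall>c t. e \<le> c \<longrightarrow> T c t)"
    using monotone_test_total[OF assms, of k] unfolding T_def by (metis nat_le_linear)
  obtain S where S: "S \<subseteq> node_lang k T (p2 j)" "finite S" "card S = Suc a"
    and uniq: "\<And>q'. S \<subseteq> node_lang k T q' \<Longrightarrow> node_lang k T (p2 j) = node_lang k T q'"
    using node_lang_teachable[OF e, of "p2 j"] by blast
  let ?h = "\<lambda>y. prod_encode (p1 j, y)"
  have inj: "inj ?h" by (simp add: inj_on_def)
  have j: "block_lang B x j = ?h ` node_lang k T (p2 j)"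
    unfolding block_lang_eq k_def T_def ..
  have "block_lang B x j = block_lang B x j'" if sub: "?h ` S \<subseteq> block_lang B x j'" for j'
  proof -
    \<comment> \<open>\<open>S\<close> is nonempty because its size is \<open>Suc a\<close>; any
      element reveals the column and thus the block.\<close>
    obtain s where "s \<in> S" using S by fastforce
    then have "p1 j' = p1 j" using sub by (auto simp: block_lang_def)
    then have j': "block_lang B x j' = ?h ` node_lang k T (p2 j')"
      unfolding block_lang_eq k_def T_def by simp
    then have "S \<subseteq> node_lang k T (p2 j')" using sub inj by (simp add: inj_image_subset_iff)
    then show ?thesis using uniq j j' by simp
  qed
  moreover have "?h ` S \<subseteq> block_lang B x j" "finite (?h ` S)" "card (?h ` S) = Suc a"
    using S inj by (auto simp: j card_image inj_on_subset)
  ultimately show ?thesis by blast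
qed

text \<open>The competitor is carried over by the injection into the column, so it stays in the same
  block.\<close>

lemma block_lang_not_teachable:
  assumes T: "\<forall>c. \<exists>t. \<not> monotone_test B x k b c t"
    and j: "p1 j = prod_encode (k, b)"
    and S: "S \<subseteq> block_lang B x j" "finite S" "card S \<le> k"
  shows "\<exists>j'. p1 j' = prod_encode (k, b) \<and> S \<subseteq> block_lang B x j' \<and>
    block_lang B x j \<noteq> block_lang B x j'"
proof -
  let ?h = "\<lambda>y. prod_encode (prod_encode (k, b), y)" and ?L = "node_lang k (monotone_test B x k b)"
  have inj: "inj ?h" by (simp add: inj_on_def)
  obtain S' where S': "S' \<subseteq> ?L (p2 j)" "S = ?h ` S'"
    using S(1) unfolding block_lang_eq j by (auto simp: subset_image_iff)
  then have "finite S'" "card S' \<le> k"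
    using S inj by (auto simp: card_image inj_on_subset finite_image_iff)
  then obtain q where "S' \<subseteq> ?L q" "?L (p2 j) \<noteq> ?L q"
    using node_lang_not_teachable[OF T S'(1)] by blast
  then show ?thesis using inj S'
    by (intro exI[of _ "prod_encode (prod_encode (k, b), q)"])
      (auto simp: block_lang_eq j inj_image_eq_iff)
qed

text \<open>A finite order \<open>k\<close> selects a block \<open>(k, b)\<close> without teaching
  sets of size at most \<open>k\<close>. In the earliest layer that meets this block, the remaining
  layers still contain the whole block, so a competitor survives.\<close>

lemma no_positive_teaching_seq:
  assumes "\<forall>a. \<exists>b. \<forall>c. \<exists>t. \<not> B (tuple5 x a b c t)"
    and seq: "positive_teaching_seq (range (block_lang B x)) I F d"
  shows "teaching_order I d = \<infinity>"
proof (rule ccontr)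
  assume "teaching_order I d \<noteq> \<infinity>"
  then obtain k where "teaching_order I d = enat k" by auto
  then have "enat (d i) \<le> enat k" if "i \<in> I" for i
    using SUP_upper[OF that, of "\<lambda>i. enat (d i)"] by (simp add: teaching_order_def)
  then have d: "d i \<le> k" if "i \<in> I" for i using that by simp
  obtain b where T: "\<forall>c. \<exists>t. \<not> monotone_test B x k b c t"
    using monotone_test_fails[OF assms(1)] by blast
  define G where "G i \<longleftrightarrow> i \<in> I \<and> (\<exists>j. p1 j = prod_encode (k, b) \<and> block_lang B x j \<in> F i)" for i
  have un: "(\<Union>i\<in>I. F i) = range (block_lang B x)"
    using seq by (simp add: positive_teaching_seq_def)
  have G: "\<exists>i. G i \<and> block_lang B x j \<in> F i" if "p1 j = prod_encode (k, b)" for j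
    using un that unfolding G_def by blast
  then have "\<exists>i. G i" by (metis p1_encode)
  define i where "i = (LEAST i. G i)"
  have "G i" unfolding i_def using \<open>\<exists>i. G i\<close> by (rule LeastI_ex)
  then obtain j where i: "i \<in> I" and j: "p1 j = prod_encode (k, b)" "block_lang B x j \<in> F i"
    unfolding G_def by blast
  have "\<forall>i\<in>I. \<forall>L\<in>F i. \<exists>S\<subseteq>L. finite S \<and> card S = d i \<and>
      (\<forall>L'\<in>(\<Union>j\<in>{j\<in>I. i \<le> j}. F j). S \<subseteq> L' \<longrightarrow> L = L')"
    using seq by (simp add: positive_teaching_seq_def)
  from this[rule_format, OF i j(2)] obtain S
    where S: "S \<subseteq> block_lang B x j" "finite S" "card S = d i"
      and uniq: "\<forall>L'\<in>(\<Union>j\<in>{j\<in>I. i \<le> j}. F j). S \<subseteq> L' \<longrightarrow> block_lang B x j = L'"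
    by auto
  obtain j' where j': "p1 j' = prod_encode (k, b)" "S \<subseteq> block_lang B x j'"
      "block_lang B x j \<noteq> block_lang B x j'"
    using block_lang_not_teachable[OF T j(1) S(1,2)] S(3) d[OF i] by auto
  obtain i' where i': "G i'" "block_lang B x j' \<in> F i'" using G j'(1) by blast
  then have "i \<le> i'" unfolding i_def by (simp add: Least_le)
  then show False using uniq i' j' by (auto simp: G_def)
qed

text \<open>Dropping the layer index from a coded triple turns an enumeration of a family into one
  of a sequence whose layers all equal that family.\<close>

lemma re_set_p2_vimage:
  assumes "re_set A"
  shows "re_set {z. p2 z \<in> A}"
proof -
  obtain r where r: "A = {x. eval r [x] \<noteq> None}" using assms unfolding re_set_def by blast
  obtain s where s: "\<And>x. eval s [x] = Some (p2 x)"
    using recursive_fun_p1_p2 unfolding recursive_fun_def by blast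
  have "{z. p2 z \<in> A} = {z. eval (Comp r [s]) [z] \<noteq> None}" by (simp add: r s)
  then show ?thesis unfolding re_set_def by blast
qed

theorem theorem13:
  fixes W :: "nat \<Rightarrow> nat set"
  assumes "acceptable_numbering W"
  shows "Sigma_hard 5 (R_ure_pos W)"
  unfolding Sigma_hard_def
proof (intro allI impI)
  fix A assume "arith_Sigma 5 A"
  then obtain B where B: "semidecidable B" and A: "\<And>x. x \<in> A \<longleftrightarrow> (\<exists>a. \<forall>b. \<exists>c. \<forall>t.
      B (tuple5 x a b c t))"
    using arith_Sigma_5 by blast
  have "range W = {A. re_set A}" and num: "\<And>V. uniformly_re V \<Longrightarrow> \<exists>f. recursive_fun f \<and> (\<forall>e. V e = W (f e))"
    using assms unfolding acceptable_numbering_def by simp_all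
  then have re_W: "re_set (W e)" for e
    using rangeI[of W e] by simp
  obtain f where f: "recursive_fun f"
    and Wf: "\<And>x. {prod_encode (j, y) | j y. y \<in> block_lang B x j} = W (f x)"
    using num[OF uniformly_re_block_lang[OF B]] by auto
  have lang: "lang W (f x) = block_lang B x" for x
    unfolding lang_def Wf[symmetric] by auto
  then have fam: "lang_family W (f x) = range (block_lang B x)" for x
    unfolding lang_family_def by auto
  have "x \<in> A \<longleftrightarrow> f x \<in> R_ure_pos W" for x
  proof
    assume "x \<in> A"
    then obtain a where a: "\<forall>b. \<exists>c. \<forall>t.
        B (tuple5 x a b c t)"
      using A by blast
    \<comment> \<open>One layer holds the whole family, since \<open>Suc a\<close> elements
      distinguish each language from all others.\<close>
    have seq: "positive_teaching_seq (lang_family W (f x)) {0} (\<lambda>_. lang_family W (f x)) (\<lambda>_. Suc a)"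
      unfolding positive_teaching_seq_def fam disjoint_family_on_def
      using block_lang_teachable[OF a] by auto
    have ord: "teaching_order {0} (\<lambda>_. Suc a) < \<infinity>" by (simp add: teaching_order_def)
    have "uniformly_re_families {0} (\<lambda>_. lang_family W (f x))"
      unfolding uniformly_re_families_def
      by (intro exI[of _ "{z. p2 z \<in> W (f x)}"])
        (simp add: re_set_p2_vimage re_W lang_family_def lang_def)
    moreover have "RTD_pos (lang_family W (f x)) < \<infinity>"
      unfolding RTD_pos_def by (rule le_less_trans[OF Inf_lower ord]) (use seq in blast)
    ultimately show "f x \<in> R_ure_pos W"
      unfolding R_ure_pos_def using seq ord by blast
  next
    assume "f x \<in> R_ure_pos W"
    then obtain I F d where seq: "positive_teaching_seq (range (block_lang B x)) I F d"
      and ord: "teaching_order I d < \<infinity>"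
      unfolding R_ure_pos_def fam[symmetric] by blast
    show "x \<in> A"
    proof (rule ccontr)
      assume "x \<notin> A"
      then have "teaching_order I d = \<infinity>"
        using A[of x] by (intro no_positive_teaching_seq[OF _ seq]) simp
      then show False using ord by simp
    qed
  qed
  then show "many_one_reducible A (R_ure_pos W)"
    unfolding many_one_reducible_def using f by blast
qed

end
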